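(* Assume $P_{ij}>0$ and $Q_{ii}>0$ for all $i,j=1,\dots,r$. Consider the system of equations in the unknowns $(\bar e,\bar f,\bar a)$: $$\lambda_iP_{ij}\bar a_i=\mu_{ij}\bar f_{ij},\quad 1\le i,j\le r,$$ $$\mu_{ij}\bar e_{ij}=Q_{ij}\sum_{k=1}^r\mu_{ki}\bar f_{ki},\quad 1\le i\neq j\le r,$$ $$\lambda_i\bar a_i=\sum_{k\ne i}\mu_{ki}\bar e_{ki}+Q_{ii}\sum_{k=1}^r\mu_{ki}\bar f_{ki},\quad 1\le i\le r,$$ $$(1-\bar a_i)\bar e_{ii}=0,\quad 1\le i\le r,$$ $$(\bar e,\bar f)\in\mathcal{T},\quad\bar a\in[0,1]^r.$$ This system has at least one solution. Moreover, any two solutions can differ only in the components $\bar e_{ii}$ for $i$ such that $\bar a_i=1$; that is, the components $\bar a$, $\bar f$, $\bar e_{ij}$ for $i\ne j$, and $\bar e_{ii}$ for $i$ such that $\bar a_i<1$ are identical across all solutions.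
   Context: Here $r\ge1$ is an integer, $\lambda_i>0$ and $\mu_{ij}>0$ ($1\le i,j\le r$) are given reals, $P=(P_{ij})$ and $Q=(Q_{ij})$ are given $r\times r$ row-stochastic matrices, and $$\mathcal{T}=\Big\{(e,f)\in[0,1]^{r\times r}\times[0,1]^{r\times r}:\ \sum_{i=1}^r\sum_{j=1}^r(e_{ij}+f_{ij})=1\Big\}.$$ *)

theory Defs
  imports "HOL-Analysis.Analysis"
begin

text \<open>Indices range over an arbitrary finite (hence nonempty) type \<open>'r\<close>, so \<open>r = CARD('r) \<ge> 1\<close>;
  the entry \<open>M\<^sub>i\<^sub>j\<close> of a matrix is \<open>M $ i $ j\<close>.\<close>

definition row_stochastic :: "real^'r^'r \<Rightarrow> bool" where
  "row_stochastic M \<longleftrightarrow> (\<forall>i j. 0 \<le> M $ i $ j) \<and> (\<forall>i. (\<Sum>j\<in>UNIV. M $ i $ j) = 1)"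

definition state_space :: "((real^'r^'r) \<times> (real^'r^'r)) set" where
  "state_space = {(e, f).
     (\<forall>i j. e $ i $ j \<in> {0..1}) \<and> (\<forall>i j. f $ i $ j \<in> {0..1}) \<and>
     (\<Sum>i\<in>UNIV. \<Sum>j\<in>UNIV. e $ i $ j + f $ i $ j) = 1}"

definition equilibrium ::
  "real^'r \<Rightarrow> real^'r^'r \<Rightarrow> real^'r^'r \<Rightarrow> real^'r^'r \<Rightarrow>
   real^'r^'r \<Rightarrow> real^'r^'r \<Rightarrow> real^'r \<Rightarrow> bool" where
  "equilibrium lam mu P Q e f a \<longleftrightarrow>
     (\<forall>i j. lam $ i * P $ i $ j * a $ i = mu $ i $ j * f $ i $ j) \<and>
     (\<forall>i j. i \<noteq> j \<longrightarrow>
        mu $ i $ j * e $ i $ j = Q $ i $ j * (\<Sum>k\<in>UNIV. mu $ k $ i * f $ k $ i)) \<and>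
     (\<forall>i. lam $ i * a $ i =
        (\<Sum>k\<in>UNIV - {i}. mu $ k $ i * e $ k $ i) +
        Q $ i $ i * (\<Sum>k\<in>UNIV. mu $ k $ i * f $ k $ i)) \<and>
     (\<forall>i. (1 - a $ i) * e $ i $ i = 0) \<and>
     (e, f) \<in> state_space \<and>
     (\<forall>i. a $ i \<in> {0..1})"

end

theory Submission
  imports Defs
begin

text \<open>
  Put \<open>w\<^sub>i = \<lambda>\<^sub>i a\<^sub>i\<close>. The first two families of equations express \<open>f\<close> and the off-diagonal part of
  \<open>e\<close> linearly in \<open>w\<close>, and the third then says \<open>w = w P Q\<close>. The stochastic matrix \<open>P Q\<close> has
  positive entries, so \<open>w = c \<pi>\<close> for its stationary distribution \<open>\<pi>\<close> and some \<open>c \<ge> 0\<close>. The total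
  mass carried by \<open>f\<close> and the off-diagonal part of \<open>e\<close> is \<open>c K\<close> with \<open>K > 0\<close>, and only the
  diagonal entries with \<open>a\<^sub>i = 1\<close> can carry the remaining \<open>1 - c K\<close>. This forces \<open>c\<close> to be the
  smaller of \<open>1 / K\<close> and \<open>min\<^sub>i \<lambda>\<^sub>i / \<pi>\<^sub>i\<close>.
\<close>

section \<open>Stationary vectors of positive stochastic matrices\<close>

lemma row_stochastic_nonneg: "row_stochastic M \<Longrightarrow> 0 \<le> M $ i $ j"
  by (simp add: row_stochastic_def)

lemma row_stochastic_sum: "row_stochastic M \<Longrightarrow> (\<Sum>j\<in>UNIV. M $ i $ j) = 1"
  by (simp add: row_stochastic_def)

text \<open>Interchanging the sums leaves the row sums of \<open>M\<close>. This serves twice: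
  applied to the rows of a matrix it gives stochasticity of products, and it keeps the simplex
  invariant in the fixed point argument.\<close>

lemma sum_vector_row_stochastic:
  fixes M :: "real^'n^'n"
  assumes "row_stochastic M"
  shows "(\<Sum>j\<in>UNIV. (x v* M) $ j) = (\<Sum>i\<in>UNIV. x $ i)"
proof -
  have "(\<Sum>j\<in>UNIV. (x v* M) $ j) = (\<Sum>j\<in>UNIV. \<Sum>i\<in>UNIV. x $ i * M $ i $ j)"
    by (simp add: vector_matrix_mult_def mult.commute)
  also have "\<dots> = (\<Sum>i\<in>UNIV. \<Sum>j\<in>UNIV. x $ i * M $ i $ j)"
    by (rule sum.swap)
  also have "\<dots> = (\<Sum>i\<in>UNIV. x $ i)"
    by (simp add: sum_distrib_left [symmetric] row_stochastic_sum [OF assms])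
  finally show ?thesis .
qed

lemma row_stochastic_mult:
  fixes M N :: "real^'n^'n"
  assumes M: "row_stochastic M" and N: "row_stochastic N"
  shows "row_stochastic (M ** N)"
proof -
  have "(\<Sum>j\<in>UNIV. (M ** N) $ i $ j) = 1" for i
  proof -
    have "(\<Sum>j\<in>UNIV. (M ** N) $ i $ j) = (\<Sum>j\<in>UNIV. (M $ i v* N) $ j)"
      by (simp add: matrix_matrix_mult_def vector_matrix_mult_def mult.commute)
    then show ?thesis
      by (simp add: sum_vector_row_stochastic [OF N] row_stochastic_sum [OF M])
  qed
  moreover have "0 \<le> (M ** N) $ i $ j" for i j
    by (simp add: matrix_matrix_mult_def sum_nonneg row_stochastic_nonneg [OF M]
        row_stochastic_nonneg [OF N])
  ultimately show ?thesis
    by (simp add: row_stochastic_def)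
qed

text \<open>In the sum for entry \<open>(i, j)\<close> the term \<open>k = j\<close> is already
  positive, thanks to the diagonal of \<open>N\<close>.\<close>

lemma positive_matrix_mult:
  fixes M N :: "real^'n^'n"
  assumes "\<And>i j. 0 < M $ i $ j" and "\<And>i j. 0 \<le> N $ i $ j" and "\<And>i. 0 < N $ i $ i"
  shows "0 < (M ** N) $ i $ j"
proof -
  have "0 < (\<Sum>k\<in>UNIV. M $ i $ k * N $ k $ j)"
    by (rule sum_pos2 [of _ j]) (auto simp: assms less_imp_le)
  then show ?thesis
    by (simp add: matrix_matrix_mult_def)
qed

text \<open>Brouwer's theorem on the probability simplex \<open>S\<close> supplies a fixed point
  \<open>p\<close>. Some \<open>p $ k\<close> is positive, and one step of \<open>M\<close> spreads
  that mass to every coordinate.\<close>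

lemma positive_stochastic_stationary:
  fixes M :: "real^'n^'n"
  assumes M: "row_stochastic M" and pos: "\<And>i j. 0 < M $ i $ j"
  obtains p where "p v* M = p" and "\<And>i. 0 < p $ i"
proof -
  define S where "S = {x::real^'n. (\<forall>i. 0 \<le> x $ i) \<and> (\<Sum>i\<in>UNIV. x $ i) = 1}"
  have "bounded S"
    unfolding bounded_iff
  proof (intro exI ballI)
    fix x assume "x \<in> S"
    then show "norm x \<le> 1"
      using norm_le_l1_cart [of x] by (simp add: S_def)
  qed
  moreover have "closed S"
    unfolding S_def
    by (intro closed_Collect_conj closed_Collect_all closed_Collect_le closed_Collect_eq
        continuous_intros)
  ultimately have "compact S"
    by (simp add: compact_eq_bounded_closed)
  moreover have "convex S"
    unfolding S_def convex_def
    by (auto simp: sum.distrib sum_distrib_left [symmetric])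
  moreover have "axis k 1 \<in> S" for k
    by (simp add: S_def axis_def)
  then have "S \<noteq> {}"
    by blast
  moreover have "continuous_on S (\<lambda>x. x v* M)"
    unfolding vector_matrix_mult_def by (intro continuous_intros)
  moreover have "(\<lambda>x. x v* M) ` S \<subseteq> S"
  proof (intro image_subsetI)
    fix x assume "x \<in> S"
    then show "x v* M \<in> S"
      using sum_vector_row_stochastic [OF M, of x]
      by (simp add: S_def vector_matrix_mult_def sum_nonneg less_imp_le [OF pos])
  qed
  ultimately obtain p where p: "p \<in> S" "p v* M = p"
    using brouwer [of S "\<lambda>x. x v* M"] by blast
  have "\<exists>k. p $ k \<noteq> 0"
  proof (rule ccontr)
    assume "\<not> ?thesis"
    then show False
      using p(1) by (simp add: S_def)
  qed
  then obtain k where "p $ k \<noteq> 0" ..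
  with p(1) have k: "0 < p $ k"
    by (simp add: S_def less_le)
  have "0 < p $ i" for i
  proof -
    have "0 < (\<Sum>j\<in>UNIV. p $ j * M $ j $ i)"
      using p(1) k by (intro sum_pos2 [of _ k]) (auto simp: S_def pos less_imp_le)
    then have "0 < (p v* M) $ i"
      by (simp add: vector_matrix_mult_def)
    then show ?thesis
      by (simp add: p(2))
  qed
  with p(2) show thesis
    by (rule that)
qed

text \<open>Subtract the largest multiple of \<open>p\<close> below \<open>w\<close>: the difference is nonnegative, stationary and has a
  zero entry, so it vanishes by positivity of \<open>M\<close>.\<close>

lemma positive_stationary_unique:
  fixes M :: "real^'n^'n"
  assumes pos: "\<And>i j. 0 < M $ i $ j"
    and p: "p v* M = p" "\<And>i. 0 < p $ i"
    and w: "w v* M = w" "\<And>i. 0 \<le> w $ i"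
  obtains c where "0 \<le> c" and "w = c *s p"
proof -
  define c where "c = Min (range (\<lambda>i. w $ i / p $ i))"
  have "c \<in> range (\<lambda>i. w $ i / p $ i)"
    unfolding c_def by (rule Min_in) auto
  then obtain k where k: "c = w $ k / p $ k"
    by blast
  have c_le: "c \<le> w $ i / p $ i" for i
    unfolding c_def by (rule Min_le) auto
  define d where "d = w - c *s p"
  have d_nonneg: "0 \<le> d $ i" for i
    using c_le [of i] p(2) [of i] by (simp add: d_def field_simps)
  have "d v* M = d"
    by (simp add: d_def vector_matrix_mult_diff_distrib p(1) w(1)
        scalar_vector_matrix_assoc)
  moreover have "d $ k = 0"
    using p(2) [of k] by (simp add: d_def k)
  ultimately have "(\<Sum>j\<in>UNIV. d $ j * M $ j $ k) = 0"
    by (metis (no_types) vector_matrix_mult_def vec_lambda_beta)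
  then have "\<forall>j. d $ j * M $ j $ k = 0"
    by (subst (asm) sum_nonneg_eq_0_iff) (auto simp: d_nonneg less_imp_le [OF pos])
  then have "d = 0"
    using pos by (simp add: vec_eq_iff less_imp_neq [THEN not_sym])
  then have "w = c *s p"
    by (simp add: d_def)
  moreover have "0 \<le> c"
    using k w(2) p(2) by (simp add: less_imp_le)
  ultimately show thesis
    using that by blast
qed

section \<open>Equilibria in terms of the departure rates\<close>

definition departure :: "real^'r \<Rightarrow> real^'r \<Rightarrow> real^'r" where
  "departure lam a = (\<chi> i. lam $ i * a $ i)"

text \<open>The mass of \<open>f\<close> plus that of the off-diagonal part of \<open>e\<close>,
  after both have been solved for in terms of \<open>w\<close>. It is linear in \<open>w\<close>;
  the constant K of the overview is its value at the stationary vector.\<close>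

definition occupancy :: "real^'r^'r \<Rightarrow> real^'r^'r \<Rightarrow> real^'r^'r \<Rightarrow> real^'r \<Rightarrow> real" where
  "occupancy mu P Q w =
     (\<Sum>i\<in>UNIV. \<Sum>j\<in>UNIV. w $ i * P $ i $ j / mu $ i $ j) +
     (\<Sum>i\<in>UNIV. \<Sum>j\<in>UNIV - {i}. Q $ i $ j * (w v* P) $ i / mu $ i $ j)"

lemma occupancy_scale: "occupancy mu P Q (c *s w) = c * occupancy mu P Q w"
  by (simp add: occupancy_def sum_distrib_left distrib_left mult_ac
      scalar_vector_matrix_assoc)

lemma occupancy_pos:
  assumes "\<And>i j. 0 < mu $ i $ j" and "\<And>i j. 0 < P $ i $ j" and "\<And>i j. 0 \<le> Q $ i $ j"
    and "\<And>i. 0 < w $ i"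
  shows "0 < occupancy mu P Q w"
proof -
  have "0 \<le> (w v* P) $ i" for i
    by (simp add: vector_matrix_mult_def sum_nonneg assms less_imp_le)
  then show ?thesis
    unfolding occupancy_def
    by (intro add_pos_nonneg sum_pos sum_nonneg) (auto simp: assms less_imp_le)
qed

lemma sum_entries_nonneg_mem_unit:
  fixes e :: "'a::finite \<Rightarrow> 'b::finite \<Rightarrow> real"
  assumes "\<And>i j. 0 \<le> e i j" and "(\<Sum>i\<in>UNIV. \<Sum>j\<in>UNIV. e i j) \<le> 1"
  shows "e i j \<in> {0..1}"
proof -
  have "e i j \<le> (\<Sum>j\<in>UNIV. e i j)"
    by (rule member_le_sum) (auto simp: assms)
  also have "\<dots> \<le> (\<Sum>i\<in>UNIV. \<Sum>j\<in>UNIV. e i j)"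
    by (rule member_le_sum) (auto simp: assms sum_nonneg)
  finally show ?thesis
    using assms by (smt (verit) atLeastAtMost_iff)
qed

text \<open>Nonnegative entries with total 1 are each bounded by that total.\<close>

lemma state_space_iff:
  fixes e f :: "real^'r^'r"
  shows "(e, f) \<in> state_space \<longleftrightarrow>
    (\<forall>i j. 0 \<le> e $ i $ j) \<and> (\<forall>i j. 0 \<le> f $ i $ j) \<and>
    (\<Sum>i\<in>UNIV. \<Sum>j\<in>UNIV. e $ i $ j + f $ i $ j) = 1"
proof
  assume R: "(\<forall>i j. 0 \<le> e $ i $ j) \<and> (\<forall>i j. 0 \<le> f $ i $ j) \<and>
    (\<Sum>i\<in>UNIV. \<Sum>j\<in>UNIV. e $ i $ j + f $ i $ j) = 1"
  then have "e $ i $ j + f $ i $ j \<in> {0..1}" for i j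
    by (intro sum_entries_nonneg_mem_unit [of "\<lambda>i j. e $ i $ j + f $ i $ j"]) auto
  with R have "e $ i $ j \<in> {0..1} \<and> f $ i $ j \<in> {0..1}" for i j
    by (smt (verit) atLeastAtMost_iff)
  with R show "(e, f) \<in> state_space"
    by (simp add: state_space_def)
qed (simp add: state_space_def)

text \<open>Solves the system successively: \<open>f\<close> from \<open>w\<close>, then
  off-diagonal \<open>e\<close>, then the balance equation as stationarity of \<open>w\<close> under
  \<open>P ** Q\<close>. What stays free is the diagonal of \<open>e\<close>, tied to
  \<open>a\<close> and to the total mass.\<close>

lemma equilibrium_iff:
  fixes lam :: "real^'r" and mu P Q :: "real^'r^'r"
  assumes lam: "\<And>i. 0 < lam $ i" and mu: "\<And>i j. 0 < mu $ i $ j"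
    and P: "\<And>i j. 0 \<le> P $ i $ j" and Q: "\<And>i j. 0 \<le> Q $ i $ j"
  defines "w \<equiv> departure lam"
  shows "equilibrium lam mu P Q e f a \<longleftrightarrow>
     (\<forall>i j. f $ i $ j = w a $ i * P $ i $ j / mu $ i $ j) \<and>
     (\<forall>i j. i \<noteq> j \<longrightarrow> e $ i $ j = Q $ i $ j * (w a v* P) $ i / mu $ i $ j) \<and>
     w a v* (P ** Q) = w a \<and>
     (\<forall>i. 0 \<le> e $ i $ i \<and> (a $ i < 1 \<longrightarrow> e $ i $ i = 0)) \<and>
     (\<Sum>i\<in>UNIV. e $ i $ i) + occupancy mu P Q (w a) = 1 \<and>
     (\<forall>i. a $ i \<in> {0..1})"
    (is "_ \<longleftrightarrow> ?F \<and> ?E \<and> ?stat \<and> ?diag \<and> ?mass \<and> ?a")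
proof -
  have w_nth: "w a $ i = lam $ i * a $ i" for i
    by (simp add: w_def departure_def)
  have F_iff: "(\<forall>i j. lam $ i * P $ i $ j * a $ i = mu $ i $ j * f $ i $ j) \<longleftrightarrow> ?F"
    using mu by (auto simp: w_nth field_simps less_imp_neq [THEN not_sym])
  have served: "(\<Sum>k\<in>UNIV. mu $ k $ i * f $ k $ i) = (w a v* P) $ i" if ?F for i
    using that mu by (simp add: vector_matrix_mult_def mult.commute less_imp_neq [THEN not_sym])
  have E_iff: "(\<forall>i j. i \<noteq> j \<longrightarrow>
      mu $ i $ j * e $ i $ j = Q $ i $ j * (\<Sum>k\<in>UNIV. mu $ k $ i * f $ k $ i)) \<longleftrightarrow> ?E" if ?F
    unfolding served [OF that]
    using mu by (auto simp: field_simps less_imp_neq [THEN not_sym])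
  \<comment> \<open>The \<open>Q $ i $ i\<close> term is exactly the summand \<open>k = i\<close>
    missing from the first sum.\<close>
  have arrivals: "(\<Sum>k\<in>UNIV - {i}. mu $ k $ i * e $ k $ i) +
      Q $ i $ i * (\<Sum>k\<in>UNIV. mu $ k $ i * f $ k $ i) = (w a v* (P ** Q)) $ i"
    if ?F ?E for i
  proof -
    have "(\<Sum>k\<in>UNIV - {i}. mu $ k $ i * e $ k $ i) =
        (\<Sum>k\<in>UNIV - {i}. (w a v* P) $ k * Q $ k $ i)"
      using \<open>?E\<close> mu by (intro sum.cong) (auto simp: less_imp_neq [THEN not_sym])
    then have "(\<Sum>k\<in>UNIV - {i}. mu $ k $ i * e $ k $ i) + (w a v* P) $ i * Q $ i $ i =
        (\<Sum>k\<in>UNIV. (w a v* P) $ k * Q $ k $ i)"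
      by (simp add: sum.remove [of UNIV i "\<lambda>k. (w a v* P) $ k * Q $ k $ i"])
    also have "\<dots> = ((w a v* P) v* Q) $ i"
      by (simp only: vector_matrix_mult_def [of "w a v* P"] vec_lambda_beta)
    finally show ?thesis
      unfolding served [OF \<open>?F\<close>] by (simp add: mult.commute vector_matrix_mul_assoc)
  qed
  have stat_iff: "(\<forall>i. lam $ i * a $ i = (\<Sum>k\<in>UNIV - {i}. mu $ k $ i * e $ k $ i) +
      Q $ i $ i * (\<Sum>k\<in>UNIV. mu $ k $ i * f $ k $ i)) \<longleftrightarrow> ?stat" if ?F ?E
    unfolding arrivals [OF that] vec_eq_iff w_nth [symmetric] by (metis (no_types))
  have mass: "(\<Sum>i\<in>UNIV. \<Sum>j\<in>UNIV. e $ i $ j + f $ i $ j) =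
      (\<Sum>i\<in>UNIV. e $ i $ i) + occupancy mu P Q (w a)" if ?F ?E
  proof -
    have "(\<Sum>j\<in>UNIV. e $ i $ j) = e $ i $ i +
        (\<Sum>j\<in>UNIV - {i}. Q $ i $ j * (w a v* P) $ i / mu $ i $ j)" for i
      using \<open>?E\<close> by (subst sum.remove [of UNIV i]) (auto intro!: sum.cong)
    with \<open>?F\<close> show ?thesis
      by (simp add: sum.distrib occupancy_def)
  qed
  \<comment> \<open>Entries expressed through \<open>w\<close> inherit their sign from
    \<open>a\<close>, so only the diagonal of \<open>e\<close> remains to be constrained.\<close>
  have nonneg_iff: "(\<forall>i j. 0 \<le> e $ i $ j) \<and> (\<forall>i j. 0 \<le> f $ i $ j) \<longleftrightarrow>
      (\<forall>i. 0 \<le> e $ i $ i)" if ?F ?E ?a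
  proof -
    have w: "0 \<le> w a $ i" for i
      using \<open>?a\<close> lam by (simp add: w_nth less_imp_le)
    then have "0 \<le> (w a v* P) $ i" for i
      by (simp add: vector_matrix_mult_def sum_nonneg P)
    then have "0 \<le> e $ i $ j" if "i \<noteq> j" for i j
      using \<open>?E\<close> that mu Q by (simp add: less_imp_le)
    moreover have "0 \<le> f $ i $ j" for i j
      using \<open>?F\<close> w mu P by (simp add: less_imp_le)
    ultimately show ?thesis
      by metis
  qed
  have diag_iff: "(\<forall>i. 0 \<le> e $ i $ i) \<and> (\<forall>i. (1 - a $ i) * e $ i $ i = 0) \<longleftrightarrow> ?diag" if ?a
    using that by (auto simp: less_le)
  show ?thesis
  \<comment> \<open>The later equivalences hold only under these three conditions; if one of them
    fails, both sides are false.\<close>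
  proof (cases "?F \<and> ?E \<and> ?a")
    case True
    then have F: ?F and E: ?E and A: ?a
      by blast+
    have state: "(e, f) \<in> state_space \<longleftrightarrow> (\<forall>i. 0 \<le> e $ i $ i) \<and> ?mass"
      unfolding state_space_iff mass [OF F E] nonneg_iff [OF F E A, symmetric]
      by (simp only: conj_assoc)
    show ?thesis
      unfolding equilibrium_def F_iff E_iff [OF F] stat_iff [OF F E] state diag_iff [OF A, symmetric]
      by (simp only: conj_ac)
  next
    case False
    then show ?thesis
      unfolding equilibrium_def F_iff using E_iff by blast
  qed
qed

lemma equilibrium_exists:
  fixes lam :: "real^'r" and mu P Q :: "real^'r^'r"
  assumes lam: "\<And>i. 0 < lam $ i" and mu: "\<And>i j. 0 < mu $ i $ j"
    and P: "\<And>i j. 0 < P $ i $ j" and Q: "\<And>i j. 0 \<le> Q $ i $ j"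
    and p: "p v* (P ** Q) = p" "\<And>i. 0 < p $ i"
  shows "\<exists>e f a. equilibrium lam mu P Q e f a"
proof -
  define K where "K = occupancy mu P Q p"
  have K: "0 < K"
    unfolding K_def by (rule occupancy_pos) (use mu P Q p in auto)
  \<comment> \<open>The largest scale \<open>c\<close> for which every
    \<open>a $ i = c * p $ i / lam $ i\<close> stays at most 1.\<close>
  define m where "m = Min (range (\<lambda>i. lam $ i / p $ i))"
  have "m \<in> range (\<lambda>i. lam $ i / p $ i)"
    unfolding m_def by (rule Min_in) auto
  then obtain s where s: "m = lam $ s / p $ s"
    by blast
  have m_le: "m \<le> lam $ i / p $ i" for i
    unfolding m_def by (rule Min_le) auto
  \<comment> \<open>The bound \<open>1 / K\<close> keeps the occupied mass \<open>c * K\<close> at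
    most 1.\<close>
  define c where "c = min (1 / K) m"
  have c: "0 \<le> c" "c * K \<le> 1" "c \<le> m"
    using K lam [of s] p(2) [of s] by (auto simp: c_def s min_def field_simps)
  define a where "a = (\<chi> i. c * p $ i / lam $ i)"
  define f where "f = (\<chi> i j. c * p $ i * P $ i $ j / mu $ i $ j)"
  \<comment> \<open>All leftover mass goes to the single diagonal entry at the minimiser
    \<open>s\<close>, the index where \<open>a\<close> reaches 1 first.\<close>
  define e where "e = (\<chi> i j. if i \<noteq> j then Q $ i $ j * ((c *s p) v* P) $ i / mu $ i $ j
    else if i = s then 1 - c * K else 0)"
  have w: "departure lam a = c *s p"
    using lam by (simp add: departure_def a_def vec_eq_iff less_imp_neq [THEN not_sym])
  have "a $ i \<in> {0..1}" for i
  proof -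
    have "c \<le> lam $ i / p $ i"
      using c(3) m_le [of i] by linarith
    then show ?thesis
      using c(1) lam [of i] p(2) [of i] by (simp add: a_def field_simps)
  qed
  \<comment> \<open>If \<open>a $ s\<close> stays below 1, the mass bound is the active one and
    nothing is left to place at \<open>s\<close>.\<close>
  moreover have "c * K = 1" if "a $ s < 1"
  proof -
    have "c \<noteq> m"
      using that lam [of s] p(2) [of s] by (auto simp: a_def s)
    then have "c = 1 / K"
      by (auto simp: c_def min_def split: if_splits)
    with K show ?thesis
      by simp
  qed
  moreover have "(\<Sum>i\<in>UNIV. e $ i $ i) = 1 - c * K"
    by (simp add: e_def)
  ultimately have "equilibrium lam mu P Q e f a"
    using c(2) by (subst equilibrium_iff)
      (auto simp: lam mu less_imp_le [OF P] Q w f_def e_def occupancy_scale p(1) K_def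
        scalar_vector_matrix_assoc)
  then show ?thesis
    by blast
qed

text \<open>A strictly smaller scale would put every \<open>a $ i\<close> below
  \<open>a' $ i\<close>, hence below 1, and so empty the diagonal of \<open>e\<close>. Then
  \<open>c\<close> times the occupancy of \<open>p\<close> is already 1, and the larger
  \<open>c'\<close> would exceed the total mass.\<close>

lemma equilibrium_departure_scale_le:
  fixes lam :: "real^'r" and mu P Q :: "real^'r^'r"
  assumes lam: "\<And>i. 0 < lam $ i" and mu: "\<And>i j. 0 < mu $ i $ j"
    and P: "\<And>i j. 0 < P $ i $ j" and Q: "\<And>i j. 0 \<le> Q $ i $ j"
    and p: "\<And>i. 0 < p $ i"
    and eq: "equilibrium lam mu P Q e f a" "departure lam a = c *s p"
    and eq': "equilibrium lam mu P Q e' f' a'" "departure lam a' = c' *s p"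
  shows "c' \<le> c"
proof (rule ccontr)
  assume "\<not> c' \<le> c"
  then have less: "c < c'"
    by simp
  note iff = equilibrium_iff [OF lam mu less_imp_le [OF P] Q]
  have "a $ i < 1" for i
  proof -
    have "lam $ i * a $ i = c * p $ i" "lam $ i * a' $ i = c' * p $ i"
      using eq(2) eq'(2) by (simp_all add: departure_def vec_eq_iff)
    with less p [of i] have "lam $ i * a $ i < lam $ i * a' $ i"
      by simp
    with lam [of i] have "a $ i < a' $ i"
      by simp
    moreover have "a' $ i \<le> 1"
      using eq'(1) by (simp add: equilibrium_def)
    ultimately show ?thesis
      by linarith
  qed
  then have "(\<Sum>i\<in>UNIV. e $ i $ i) = 0"
    using eq(1) by (intro sum.neutral) (simp add: iff)
  then have "c * occupancy mu P Q p = 1"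
    using eq by (simp add: iff occupancy_scale)
  moreover have "c' * occupancy mu P Q p \<le> 1"
  proof -
    have "0 \<le> (\<Sum>i\<in>UNIV. e' $ i $ i)"
      using eq'(1) by (intro sum_nonneg) (simp add: iff)
    then show ?thesis
      using eq' by (simp add: iff occupancy_scale)
  qed
  moreover have "0 < occupancy mu P Q p"
    by (rule occupancy_pos) (use mu P Q p in auto)
  ultimately show False
    using less by (smt (verit) mult_strict_right_mono)
qed

theorem lemma3:
  fixes lam :: "real^'r" and mu P Q :: "real^'r^'r"
  assumes "\<And>i. lam $ i > 0"
    and "\<And>i j. mu $ i $ j > 0"
    and "row_stochastic P"
    and "row_stochastic Q"
    and "\<And>i j. P $ i $ j > 0"
    and "\<And>i. Q $ i $ i > 0"
  shows "(\<exists>e f a. equilibrium lam mu P Q e f a) \<and>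
    (\<forall>e f a e' f' a'.
       equilibrium lam mu P Q e f a \<and> equilibrium lam mu P Q e' f' a' \<longrightarrow>
         a = a' \<and> f = f' \<and>
         (\<forall>i j. i \<noteq> j \<longrightarrow> e $ i $ j = e' $ i $ j) \<and>
         (\<forall>i. a $ i < 1 \<longrightarrow> e $ i $ i = e' $ i $ i))"
proof -
  note lam = assms(1) and mu = assms(2) and P = assms(5)
  have Q: "\<And>i j. 0 \<le> Q $ i $ j"
    using assms(4) by (rule row_stochastic_nonneg)
  have pos: "0 < (P ** Q) $ i $ j" for i j
    using P Q assms(6) by (rule positive_matrix_mult)
  obtain p where p: "p v* (P ** Q) = p" "\<And>i. 0 < p $ i"
    using positive_stochastic_stationary [OF row_stochastic_mult [OF assms(3,4)] pos] by blast
  note iff = equilibrium_iff [OF lam mu less_imp_le [OF P] Q]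
  have scale: "\<exists>c. departure lam a = c *s p" if "equilibrium lam mu P Q e f a" for e f a
  proof -
    have "departure lam a v* (P ** Q) = departure lam a"
      using that by (simp add: iff)
    moreover have "0 \<le> a $ i" for i
      using that by (simp add: equilibrium_def)
    then have "0 \<le> departure lam a $ i" for i
      using lam by (simp add: departure_def less_imp_le)
    ultimately show ?thesis
      using positive_stationary_unique [OF pos p] by metis
  qed
  have "a = a' \<and> f = f' \<and> (\<forall>i j. i \<noteq> j \<longrightarrow> e $ i $ j = e' $ i $ j) \<and>
      (\<forall>i. a $ i < 1 \<longrightarrow> e $ i $ i = e' $ i $ i)"
    if eq: "equilibrium lam mu P Q e f a" and eq': "equilibrium lam mu P Q e' f' a'"
    for e f a e' f' a'
  proof -
    obtain c c' where c: "departure lam a = c *s p" and c': "departure lam a' = c' *s p"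
      using scale eq eq' by blast
    \<comment> \<open>The scale comparison is used in both directions, with the two solutions
      exchanged.\<close>
    have "c = c'"
      using equilibrium_departure_scale_le [OF lam mu P Q p(2)] eq c eq' c' by (metis antisym)
    then have w: "departure lam a = departure lam a'"
      by (simp add: c c')
    then have "a = a'"
      using lam by (simp add: departure_def vec_eq_iff less_imp_neq [THEN not_sym])
    \<comment> \<open>By \<open>iff\<close>, the common \<open>w\<close> fixes \<open>f\<close> and
      the off-diagonal part of \<open>e\<close>, and \<open>e $ i $ i\<close> is 0 in both solutions
      whenever \<open>a $ i < 1\<close>.\<close>
    then show ?thesis
      using eq eq' unfolding \<open>a = a'\<close> by (simp add: iff vec_eq_iff)
  qed
  moreover have "\<exists>e f a. equilibrium lam mu P Q e f a"
    using lam mu P Q p by (rule equilibrium_exists)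
  ultimately show ?thesis
    by blast
qed

end
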